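(* Suppose $\alpha,\beta$ are rational numbers with $0 < \alpha + 1 < \beta$. Then $$\mathrm{SC}\bigl(\lambda n.\, n/(\log_2 n)^\beta\bigr) \leq_{\mathrm{s}} \mathrm{COMPLEX}\bigl(\lambda n.\, n/(\log_2 n)^\alpha\bigr).$$
   Context: Prefix-free complexity: a prefix-free machine is a partial recursive $M$ from $\{0,1\}^*$ to $\{0,1\}^*$ with prefix-free domain; $U$ is universal if for each prefix-free machine $M$ there is $\rho$ with $U(\rho^\frown\tau)\simeq M(\tau)$ for all $\tau$. Fix a universal $U$ and let $K(\sigma)=\min\{|\tau| : U(\tau)=\sigma\}$. For $f\colon\mathbb{N}\to\mathbb{R}$, $\mathrm{COMPLEX}(f)$ is the set of $X\in\{0,1\}^{\mathbb{N}}$ for which there is $c\in\mathbb{N}$ with $K(X\upharpoonright n)\geq f(n)-c$ for all $n$; $\mathrm{SC}(f)$ is the set of $X\in\{0,1\}^{\mathbb{N}}$ for which there is $c\in\mathbb{N}$ with $K(\tau)\geq f(|\tau|)-c$ for every (contiguous, finite) substring $\tau$ of $X$. In both definitions, because of the constant $c$, finitely many values of $f$ are irrelevant; if $f$ is only suitable (defined and nondecreasing) for $n\geq a$, its values for $n<a$ are set to $f(a)$. For $P,Q\subseteq\mathbb{N}^{\mathbb{N}}$, $P\leq_{\mathrm{s}}Q$ means there is a partial recursive functional defined on all of $Q$ that maps $Q$ into $P$. *)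

theory Defs
  imports Complex_Main "HOL-Library.Sublist"
begin

text \<open>
  Kleene schemata with an oracle. A program denotes a partial recursive functional; a program
  without \<open>Oracle\<close> denotes a partial recursive function.
\<close>

datatype prog =
    Zero
  | Succ
  | Proj nat
  | Oracle
  | Comp prog "prog list"
  | PrimRec prog prog
  | Mu prog

text \<open>\<open>eval g p xs y\<close>: with oracle \<open>g\<close>, program \<open>p\<close> halts on the arguments \<open>xs\<close> with value \<open>y\<close>.\<close>

inductive eval :: "(nat \<Rightarrow> nat) \<Rightarrow> prog \<Rightarrow> nat list \<Rightarrow> nat \<Rightarrow> bool"
  for g :: "nat \<Rightarrow> nat"
where
  eval_Zero: "eval g Zero xs 0"
| eval_Succ: "eval g Succ [x] (Suc x)"
| eval_Proj: "i < length xs \<Longrightarrow> eval g (Proj i) xs (xs ! i)"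
| eval_Oracle: "eval g Oracle [x] (g x)"
| eval_Comp: "\<lbrakk>list_all2 (\<lambda>q y. eval g q xs y) qs ys; eval g p ys z\<rbrakk> \<Longrightarrow> eval g (Comp p qs) xs z"
| eval_PrimRec_0: "eval g p xs y \<Longrightarrow> eval g (PrimRec p q) (0 # xs) y"
| eval_PrimRec_Suc: "\<lbrakk>eval g (PrimRec p q) (n # xs) r; eval g q (n # r # xs) y\<rbrakk>
    \<Longrightarrow> eval g (PrimRec p q) (Suc n # xs) y"
| eval_Mu: "\<lbrakk>eval g p (n # xs) 0; \<forall>m<n. \<exists>y. eval g p (m # xs) (Suc y)\<rbrakk> \<Longrightarrow> eval g (Mu p) xs n"
monos list_all2_mono

lemma eval_deterministic: "eval g p xs y \<Longrightarrow> eval g p xs z \<Longrightarrow> y = z"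
proof (induction arbitrary: z rule: eval.induct)
  case (eval_Comp xs qs ys p y)
  from eval_Comp.prems show ?case
  proof cases
    case C: (eval_Comp ys')
    have "length ys' = length ys"
      using list_all2_lengthD[OF eval_Comp.IH(1)] list_all2_lengthD[OF C(1)] by linarith
    moreover have "ys' ! i = ys ! i" if "i < length ys'" for i
    proof -
      have "eval g (qs ! i) xs (ys' ! i)"
        using C(1) that by (simp add: list_all2_conv_all_nth)
      moreover have "\<forall>z. eval g (qs ! i) xs z \<longrightarrow> ys ! i = z"
        using list_all2_nthD[OF eval_Comp.IH(1), of i] that list_all2_lengthD[OF C(1)]
        by (simp only:) blast
      ultimately show ?thesis by simp
    qed
    ultimately have "ys' = ys" by (intro nth_equalityI) simp_all
    with C(2) eval_Comp.IH(2) show ?thesis by simp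
  qed
next
  case (eval_PrimRec_Suc p q n xs r y)
  from eval_PrimRec_Suc.prems show ?case
  proof cases
    case P: (eval_PrimRec_Suc r')
    from eval_PrimRec_Suc.IH(1)[OF P(1)] eval_PrimRec_Suc.IH(2) P(2)
    show ?thesis by simp
  qed
next
  case (eval_PrimRec_0 p xs y q)
  from eval_PrimRec_0.prems show ?case
    by cases (rule eval_PrimRec_0.IH)
next
  case (eval_Mu p n xs)
  from eval_Mu.prems have z: "eval g p (z # xs) 0" "\<forall>m<z. \<exists>y. eval g p (m # xs) (Suc y)"
    by (cases; simp)+
  have "\<not> z < n" using eval_Mu.IH(2) z(1) by auto
  moreover have "\<not> n < z" using eval_Mu.IH(1) z(2) by auto
  ultimately show ?case by simp
next
  case (eval_Zero xs)
  from eval_Zero.prems show ?case by cases simp_all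
next
  case (eval_Succ x)
  from eval_Succ.prems show ?case by cases simp_all
next
  case (eval_Proj i xs)
  from eval_Proj.prems show ?case by cases simp_all
next
  case (eval_Oracle x)
  from eval_Oracle.prems show ?case by cases simp_all
qed

primrec oracle_free :: "prog \<Rightarrow> bool" where
  "oracle_free Zero \<longleftrightarrow> True"
| "oracle_free Succ \<longleftrightarrow> True"
| "oracle_free (Proj i) \<longleftrightarrow> True"
| "oracle_free Oracle \<longleftrightarrow> False"
| "oracle_free (Comp p qs) \<longleftrightarrow> oracle_free p \<and> list_all id (map oracle_free qs)"
| "oracle_free (PrimRec p q) \<longleftrightarrow> oracle_free p \<and> oracle_free q"
| "oracle_free (Mu p) \<longleftrightarrow> oracle_free p"

primrec str_code :: "bool list \<Rightarrow> nat" where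
  "str_code [] = 0"
| "str_code (b # \<sigma>) = 2 * str_code \<sigma> + (if b then 2 else 1)"

lemma bij_str_code: "bij str_code"
proof (rule bijI)
  show "inj str_code"
  proof (rule injI)
    fix \<sigma> \<tau>
    show "str_code \<sigma> = str_code \<tau> \<Longrightarrow> \<sigma> = \<tau>"
    proof (induction \<sigma> arbitrary: \<tau>)
      case Nil
      then show ?case by (cases \<tau>) (auto split: if_splits)
    next
      case (Cons b \<sigma>)
      then obtain b' \<tau>' where \<tau>: "\<tau> = b' # \<tau>'" by (cases \<tau>) (auto split: if_splits)
      from Cons.prems have "b = b' \<and> str_code \<sigma> = str_code \<tau>'"
        unfolding \<tau> by (cases b; cases b') (simp_all, presburger+)
      with Cons.IH \<tau> show ?case by auto
    qed
  qed
  have "\<exists>\<sigma>. str_code \<sigma> = n" for n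
  proof (induction n rule: less_induct)
    case (less n)
    show ?case
    proof (cases "n = 0")
      case True
      then show ?thesis by (metis str_code.simps(1))
    next
      case False
      then have "(n - 1) div 2 < n" by linarith
      from less.IH[OF this] obtain \<sigma> where "str_code \<sigma> = (n - 1) div 2" by blast
      then have "str_code (even n # \<sigma>) = n" using False by simp presburger
      then show ?thesis by blast
    qed
  qed
  then show "surj str_code" by (metis surjI)
qed

definition partial_recursive :: "(bool list \<rightharpoonup> bool list) \<Rightarrow> bool" where
  "partial_recursive M \<longleftrightarrow> (\<exists>p. oracle_free p \<and>
     (\<forall>\<sigma> \<tau>. M \<sigma> = Some \<tau> \<longleftrightarrow> eval (\<lambda>_. 0) p [str_code \<sigma>] (str_code \<tau>)))"

definition strongly_reducible :: "(nat \<Rightarrow> nat) set \<Rightarrow> (nat \<Rightarrow> nat) set \<Rightarrow> bool"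
    (infix \<open>\<le>\<^sub>s\<close> 50) where
  "P \<le>\<^sub>s Q \<longleftrightarrow> (\<exists>p. \<forall>g\<in>Q. \<exists>h\<in>P. \<forall>n. eval g p [n] (h n))"

definition prefix_free :: "bool list set \<Rightarrow> bool" where
  "prefix_free A \<longleftrightarrow> (\<forall>\<sigma>\<in>A. \<forall>\<tau>\<in>A. \<not> strict_prefix \<sigma> \<tau>)"

definition prefix_free_machine :: "(bool list \<rightharpoonup> bool list) \<Rightarrow> bool" where
  "prefix_free_machine M \<longleftrightarrow> partial_recursive M \<and> prefix_free (dom M)"

definition universal_machine :: "(bool list \<rightharpoonup> bool list) \<Rightarrow> bool" where
  "universal_machine U \<longleftrightarrow> prefix_free_machine U \<and>
     (\<forall>M. prefix_free_machine M \<longrightarrow> (\<exists>\<rho>. \<forall>\<tau>. U (\<rho> @ \<tau>) = M \<tau>))"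

definition K :: "(bool list \<rightharpoonup> bool list) \<Rightarrow> bool list \<Rightarrow> nat" where
  "K U \<sigma> = (LEAST n. \<exists>\<tau>. length \<tau> = n \<and> U \<tau> = Some \<sigma>)"

definition restrict :: "(nat \<Rightarrow> bool) \<Rightarrow> nat \<Rightarrow> bool list" (infix \<open>\<restriction>\<close> 90) where
  "X \<restriction> n = map X [0..<n]"

definition substring_of :: "bool list \<Rightarrow> (nat \<Rightarrow> bool) \<Rightarrow> bool" where
  "substring_of \<tau> X \<longleftrightarrow> (\<exists>i. \<tau> = map X [i..<i + length \<tau>])"

definition COMPLEX :: "(bool list \<rightharpoonup> bool list) \<Rightarrow> (nat \<Rightarrow> real) \<Rightarrow> (nat \<Rightarrow> bool) set" where
  "COMPLEX U f = {X. \<exists>c::nat. \<forall>n. real (K U (X \<restriction> n)) \<ge> f n - real c}"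

definition SC :: "(bool list \<rightharpoonup> bool list) \<Rightarrow> (nat \<Rightarrow> real) \<Rightarrow> (nat \<Rightarrow> bool) set" where
  "SC U f = {X. \<exists>c::nat. \<forall>\<tau>. substring_of \<tau> X \<longrightarrow> real (K U \<tau>) \<ge> f (length \<tau>) - real c}"

definition to_baire :: "(nat \<Rightarrow> bool) \<Rightarrow> nat \<Rightarrow> nat" where
  "to_baire X n = of_bool (X n)"

definition n_over_log_raw :: "real \<Rightarrow> nat \<Rightarrow> real" where
  "n_over_log_raw \<gamma> n = real n / log 2 (real n) powr \<gamma>"

text \<open>
  \<open>n / (log\<^sub>2 n)\<^sup>\<gamma>\<close> is unproblematic for \<open>n \<ge> 2\<close> only, where the logarithm is positive.
\<close>

definition suitable_from :: "real \<Rightarrow> nat \<Rightarrow> bool" where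
  "suitable_from \<gamma> a \<longleftrightarrow> a \<ge> 2 \<and> mono_on {a..} (n_over_log_raw \<gamma>)"

text \<open>
  Below the threshold \<open>a\<close> the function is constant with value \<open>f a\<close>. Any other suitable threshold
  changes finitely many values, hence yields the same classes \<open>COMPLEX\<close> and \<open>SC\<close>.
\<close>

definition n_over_log :: "real \<Rightarrow> nat \<Rightarrow> real" where
  "n_over_log \<gamma> n = n_over_log_raw \<gamma> (max n (LEAST a. suitable_from \<gamma> a))"

lemma ex_suitable_from: "\<exists>a. suitable_from \<gamma> a"
proof
  define a where "a = max 2 (nat \<lceil>exp \<gamma>\<rceil>)"
  have a: "a \<ge> 2" "exp \<gamma> \<le> real a"
    unfolding a_def by linarith+
  have "n_over_log_raw \<gamma> m \<le> n_over_log_raw \<gamma> n" if mn: "a \<le> m" "m \<le> n" for m n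
  proof -
    have m: "real m \<ge> 2" "exp \<gamma> \<le> real m"
      using a mn by linarith+
    let ?f = "\<lambda>x::real. x / log 2 x powr \<gamma>"
    have "?f (real m) \<le> ?f (real n)"
    proof (rule DERIV_nonneg_imp_nondecreasing[where f = ?f])
      show "real m \<le> real n" using mn by simp
      fix x assume x: "real m \<le> x" "x \<le> real n"
      then have x2: "x \<ge> 2" "exp \<gamma> \<le> x" using m by linarith+
      then have lx: "ln x > 0" "\<gamma> \<le> ln x" by (auto simp: ln_ge_iff)
      define L where "L = log 2 x"
      define D where "D = L powr \<gamma>"
      have L: "L > 0" using x2 unfolding L_def by simp
      then have D: "D > 0" by (simp add: D_def)
      have Lln: "L * ln 2 = ln x" unfolding L_def log_def by simp
      have "(log 2 has_real_derivative 1 / (ln 2 * x)) (at x)"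
        using x2 by (intro DERIV_log) auto
      from DERIV_fun_powr[OF this, of \<gamma>]
      have "((\<lambda>x. log 2 x powr \<gamma>) has_real_derivative
          \<gamma> * L powr (\<gamma> - 1) * (1 / (ln 2 * x))) (at x)"
        using L by (simp add: L_def)
      from DERIV_divide[OF DERIV_ident this]
      have "(?f has_real_derivative
          (1 * D - x * (\<gamma> * L powr (\<gamma> - 1) * (1 / (ln 2 * x)))) / (D * D)) (at x)"
        using D by (simp add: L_def D_def)
      moreover have "x * (\<gamma> * L powr (\<gamma> - 1) * (1 / (ln 2 * x))) = D * (\<gamma> / ln x)"
      proof -
        have "L powr (\<gamma> - 1) = D / L" using L by (simp add: powr_diff D_def)
        then show ?thesis using x2 L by (simp add: Lln[symmetric])
      qed
      moreover have "D * (\<gamma> / ln x) \<le> D * 1"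
        using lx D by (intro mult_left_mono) auto
      then have "0 \<le> (1 * D - D * (\<gamma> / ln x)) / (D * D)"
        using D by (intro divide_nonneg_nonneg) auto
      ultimately show "\<exists>y. (?f has_real_derivative y) (at x) \<and> 0 \<le> y"
        by auto
    qed
    then show ?thesis by (simp add: n_over_log_raw_def)
  qed
  then show "suitable_from \<gamma> a"
    using a by (auto simp: suitable_from_def intro!: mono_onI)
qed

lemma suitable_from_Least: "suitable_from \<gamma> (LEAST a. suitable_from \<gamma> a)"
  using ex_suitable_from by (metis LeastI)

end

theory Submission
  imports Defs "HOL-Real_Asymp.Real_Asymp"
begin

text \<open>
  From \<open>X\<close> compute a Toeplitz sequence \<open>Y\<close> that, for each \<open>t\<close>, repeats the prefix of \<open>X\<close> of length
  \<open>2\<^sup>t\<close> along an arithmetic progression of difference \<open>2\<^sup>u\<close>, where \<open>u\<close> depends on \<open>t\<close>. Disjoint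
  progressions exist with \<open>2\<^sup>u\<close> about \<open>t\<^bsup>1 + 1/q\<^esup>\<close>, because these densities are summable. Every
  substring \<open>\<tau>\<close> of \<open>Y\<close> of length about \<open>2\<^bsup>t + u\<^esup>\<close> contains the prefix up to a shift, so
  \<open>K(\<tau>) \<ge> 2\<^sup>t / t\<^sup>\<alpha> - O(t)\<close>, and this exceeds \<open>|\<tau>| / (log |\<tau>|)\<^sup>\<beta>\<close> once \<open>\<alpha> + 1 + 1/q < \<beta>\<close>.
\<close>

section \<open>Programs\<close>

lemma eval_Zero_iff [simp]: "eval g Zero xs y \<longleftrightarrow> y = 0"
  by (auto intro: eval.intros elim: eval.cases)

lemma eval_Succ_iff [simp]: "eval g Succ xs y \<longleftrightarrow> (\<exists>x. xs = [x] \<and> y = Suc x)"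
  by (auto intro: eval.intros elim: eval.cases)

lemma eval_Proj_iff [simp]: "eval g (Proj i) xs y \<longleftrightarrow> i < length xs \<and> y = xs ! i"
  by (auto intro: eval.intros elim: eval.cases)

lemma eval_Oracle_iff [simp]: "eval g Oracle xs y \<longleftrightarrow> (\<exists>x. xs = [x] \<and> y = g x)"
  by (auto intro: eval.intros elim: eval.cases)

lemma eval_Comp_iff:
  "eval g (Comp p qs) xs z \<longleftrightarrow> (\<exists>ys. list_all2 (\<lambda>q y. eval g q xs y) qs ys \<and> eval g p ys z)"
  by (auto intro: eval.intros elim: eval.cases)

text \<open>One existential per component, nested so that the simplifier substitutes each determined
  value before it reaches the next component.\<close>

lemma ex_list_all2_Cons:
  "(\<exists>ys. list_all2 P (x # xs) ys \<and> R ys) \<longleftrightarrow> (\<exists>y. P x y \<and> (\<exists>ys. list_all2 P xs ys \<and> R (y # ys)))"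
  by (auto simp: list_all2_Cons1)

lemma eval_Comp1_iff [simp]:
  "eval g (Comp p [q]) xs z \<longleftrightarrow> (\<exists>a. eval g q xs a \<and> eval g p [a] z)"
  by (simp add: eval_Comp_iff ex_list_all2_Cons)

lemma eval_Comp2_iff [simp]:
  "eval g (Comp p [q1, q2]) xs z \<longleftrightarrow> (\<exists>a. eval g q1 xs a \<and> (\<exists>b. eval g q2 xs b \<and> eval g p [a, b] z))"
  by (simp add: eval_Comp_iff ex_list_all2_Cons)

lemma eval_Comp3_iff [simp]:
  "eval g (Comp p [q1, q2, q3]) xs z \<longleftrightarrow>
    (\<exists>a. eval g q1 xs a \<and> (\<exists>b. eval g q2 xs b \<and> (\<exists>c. eval g q3 xs c \<and> eval g p [a, b, c] z)))"
  by (simp add: eval_Comp_iff ex_list_all2_Cons)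

lemma eval_Comp4_iff [simp]:
  "eval g (Comp p [q1, q2, q3, q4]) xs z \<longleftrightarrow>
    (\<exists>a. eval g q1 xs a \<and> (\<exists>b. eval g q2 xs b \<and> (\<exists>c. eval g q3 xs c \<and>
      (\<exists>d. eval g q4 xs d \<and> eval g p [a, b, c, d] z))))"
  by (simp add: eval_Comp_iff ex_list_all2_Cons)

lemma eval_PrimRec_0_iff: "eval g (PrimRec p q) (0 # xs) y \<longleftrightarrow> eval g p xs y"
  by (auto intro: eval.intros elim: eval.cases)

lemma eval_PrimRec_Suc_iff:
  "eval g (PrimRec p q) (Suc n # xs) y \<longleftrightarrow>
    (\<exists>r. eval g (PrimRec p q) (n # xs) r \<and> eval g q (n # r # xs) y)"
  by (auto intro: eval.intros elim: eval.cases)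

text \<open>The equivalence gives halting and uniqueness at once, so evaluating the arithmetic
  programs becomes rewriting.\<close>

lemma eval_PrimRec_total:
  assumes "\<And>y. eval g p xs y \<longleftrightarrow> y = F 0"
    and "\<And>n y. eval g q (n # F n # xs) y \<longleftrightarrow> y = F (Suc n)"
  shows "eval g (PrimRec p q) (n # xs) y \<longleftrightarrow> y = F n"
  using assms by (induction n arbitrary: y) (simp_all add: eval_PrimRec_0_iff eval_PrimRec_Suc_iff)

lemma eval_Mu_iff:
  "eval g (Mu p) xs n \<longleftrightarrow> eval g p (n # xs) 0 \<and> (\<forall>m<n. \<exists>y. eval g p (m # xs) (Suc y))"
  by (auto intro: eval.intros elim: eval.cases)

definition "Add_prog = PrimRec (Proj 0) (Comp Succ [Proj 1])"
definition "Mult_prog = PrimRec Zero (Comp Add_prog [Proj 1, Proj 2])"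
definition "Pred_prog = PrimRec Zero (Proj 0)"
definition "Sub_prog = PrimRec (Proj 0) (Comp Pred_prog [Proj 1])"
definition "Pow2_prog = PrimRec (Comp Succ [Zero]) (Comp Add_prog [Proj 1, Proj 1])"
definition "Parity_prog = PrimRec Zero (Comp Sub_prog [Proj 1, Comp Succ [Zero]])"
definition "Half_prog = PrimRec Zero (Comp Add_prog [Proj 1, Comp Parity_prog [Proj 0]])"
definition "Shift_prog = PrimRec (Proj 0) (Comp Half_prog [Proj 1])"
definition "Mod2_prog =
  Comp Sub_prog [Comp Mult_prog [Comp Pow2_prog [Proj 0], Shift_prog], Proj 1]"
definition "Drop_prog = Comp Pred_prog [Comp Shift_prog [Proj 0, Comp Succ [Proj 1]]]"

primrec Const_prog :: "nat \<Rightarrow> prog" where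
  "Const_prog 0 = Zero"
| "Const_prog (Suc n) = Comp Succ [Const_prog n]"

lemma oracle_free_arith [simp]:
  "oracle_free Add_prog" "oracle_free Mult_prog" "oracle_free Pred_prog" "oracle_free Sub_prog"
  "oracle_free Pow2_prog" "oracle_free Parity_prog" "oracle_free Half_prog"
  "oracle_free Shift_prog" "oracle_free Mod2_prog" "oracle_free Drop_prog"
  "oracle_free (Const_prog n)"
  by (induction n) (simp_all add: Add_prog_def Mult_prog_def Pred_prog_def Sub_prog_def
      Pow2_prog_def Parity_prog_def Half_prog_def Shift_prog_def Mod2_prog_def Drop_prog_def)

lemma eval_Add [simp]: "eval g Add_prog [m, n] y \<longleftrightarrow> y = m + n"
  unfolding Add_prog_def by (rule eval_PrimRec_total) auto

lemma eval_Mult [simp]: "eval g Mult_prog [m, n] y \<longleftrightarrow> y = m * n"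
  unfolding Mult_prog_def by (rule eval_PrimRec_total) auto

lemma eval_Pred [simp]: "eval g Pred_prog [n] y \<longleftrightarrow> y = n - 1"
  unfolding Pred_prog_def by (rule eval_PrimRec_total) auto

lemma eval_Sub [simp]: "eval g Sub_prog [m, n] y \<longleftrightarrow> y = n - m"
  unfolding Sub_prog_def by (rule eval_PrimRec_total) auto

lemma eval_Pow2 [simp]: "eval g Pow2_prog [n] y \<longleftrightarrow> y = 2 ^ n"
  unfolding Pow2_prog_def by (rule eval_PrimRec_total) auto

lemma eval_Parity [simp]: "eval g Parity_prog [n] y \<longleftrightarrow> y = n mod 2"
  unfolding Parity_prog_def by (rule eval_PrimRec_total) (auto simp: mod_Suc)

lemma eval_Half [simp]: "eval g Half_prog [n] y \<longleftrightarrow> y = n div 2"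
  unfolding Half_prog_def by (rule eval_PrimRec_total) (simp, simp, presburger)

lemma eval_Shift [simp]: "eval g Shift_prog [k, n] y \<longleftrightarrow> y = n div 2 ^ k"
  unfolding Shift_prog_def
  by (rule eval_PrimRec_total) (auto simp: div_mult2_eq mult.commute[of 2])

lemma eval_Mod2 [simp]: "eval g Mod2_prog [k, n] y \<longleftrightarrow> y = n mod 2 ^ k"
  by (simp add: Mod2_prog_def minus_mult_div_eq_mod)

lemma eval_Drop [simp]: "eval g Drop_prog [k, n] y \<longleftrightarrow> y = Suc n div 2 ^ k - 1"
  by (simp add: Drop_prog_def)

lemma eval_Const [simp]: "eval g (Const_prog n) xs y \<longleftrightarrow> y = n"
  by (induction n arbitrary: y) auto

section \<open>String codes\<close>

lemma str_code_append: "str_code (\<sigma> @ \<tau>) = str_code \<sigma> + 2 ^ length \<sigma> * str_code \<tau>"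
  by (induction \<sigma>) (auto simp: algebra_simps)

text \<open>The successor of a code is the string in binary, least significant bit first, below a
  leading 1.\<close>

lemma Suc_str_code_bounds: "2 ^ length \<sigma> \<le> Suc (str_code \<sigma>)" "Suc (str_code \<sigma>) < 2 ^ Suc (length \<sigma>)"
  by (induction \<sigma>) auto

text \<open>Halving the successor deletes its lowest digit, the first letter. Past the end the
  quotient is 0, and truncated subtraction returns the code of the empty string.\<close>

lemma str_code_drop: "str_code (drop k \<sigma>) = Suc (str_code \<sigma>) div 2 ^ k - 1"
proof (induction k arbitrary: \<sigma>)
  case (Suc k)
  show ?case
  proof (cases \<sigma>)
    case (Cons b \<sigma>')
    have "Suc (str_code \<sigma>) div 2 = Suc (str_code \<sigma>')" using Cons by auto
    then have "Suc (str_code \<sigma>) div 2 ^ Suc k = Suc (str_code \<sigma>') div 2 ^ k"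
      by (simp add: div_mult2_eq)
    with Suc[of \<sigma>'] Cons show ?thesis by simp
  qed (simp add: power_Suc)
qed simp

lemma odd_str_code_iff: "odd (str_code \<sigma>) \<longleftrightarrow> (\<exists>\<rho>. \<sigma> = False # \<rho>)"
  by (cases \<sigma>) auto

lemma str_code_nth: "i < length \<sigma> \<Longrightarrow> odd (Suc (str_code \<sigma>) div 2 ^ i) \<longleftrightarrow> \<sigma> ! i"
proof (induction \<sigma> arbitrary: i)
  case (Cons b \<sigma>)
  show ?case
  proof (cases i)
    case (Suc j)
    have "Suc (str_code (b # \<sigma>)) div 2 = Suc (str_code \<sigma>)" by auto
    then have "Suc (str_code (b # \<sigma>)) div 2 ^ i = Suc (str_code \<sigma>) div 2 ^ j"
      using Suc by (simp add: div_mult2_eq del: str_code.simps)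
    with Cons Suc show ?thesis by simp
  qed auto
qed simp

text \<open>Lets a machine read a number from e letters by reducing the code of all its remaining
  input: the letters after \<open>b\<close> affect only higher digits.\<close>

lemma ex_str_code_mod:
  assumes "r < 2 ^ e"
  obtains b where "length b = e" "\<And>\<rho>. Suc (str_code (b @ \<rho>)) mod 2 ^ e = r"
proof -
  \<comment> \<open>Below its leading 1, the number 2^e + r shows the digits of r padded to length
    e.\<close>
  obtain b where b: "str_code b = 2 ^ e + r - 1"
    using bij_str_code by (metis bij_pointE)
  then have sb: "Suc (str_code b) = 2 ^ e + r" by simp
  have "(2::nat) ^ length b < 2 ^ Suc e" "(2::nat) ^ e < 2 ^ Suc (length b)"
    using Suc_str_code_bounds[of b] assms unfolding sb by auto
  then have "length b < Suc e" "e < Suc (length b)" by (simp_all only: power_strict_increasing_iff one_less_numeral_iff semiring_norm)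
  then have len: "length b = e" by simp
  have "Suc (str_code (b @ \<rho>)) mod 2 ^ e = r" for \<rho>
  proof -
    have "Suc (str_code (b @ \<rho>)) = r + 2 ^ e * Suc (str_code \<rho>)"
      using sb len by (simp add: str_code_append)
    then show ?thesis using assms by (simp only: mod_mult_self2 mod_less)
  qed
  with len that show thesis by blast
qed

section \<open>Universal machines\<close>

lemma prog_machine:
  assumes U: "universal_machine U" and p: "oracle_free p"
    and pf: "\<And>\<sigma> \<xi> y z. eval (\<lambda>_. 0) p [str_code \<sigma>] y \<Longrightarrow>
      eval (\<lambda>_. 0) p [str_code (\<sigma> @ \<xi>)] z \<Longrightarrow> \<xi> = []"
  obtains \<rho> where "\<And>\<sigma> \<tau>. U (\<rho> @ \<sigma>) = Some \<tau> \<longleftrightarrow> eval (\<lambda>_. 0) p [str_code \<sigma>] (str_code \<tau>)"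
proof -
  let ?R = "\<lambda>\<sigma> \<tau>. eval (\<lambda>_. 0) p [str_code \<sigma>] (str_code \<tau>)"
  define M where "M \<sigma> = (if \<exists>\<tau>. ?R \<sigma> \<tau> then Some (SOME \<tau>. ?R \<sigma> \<tau>) else None)" for \<sigma>
  have uniq: "\<tau> = \<tau>'" if "?R \<sigma> \<tau>" "?R \<sigma> \<tau>'" for \<sigma> \<tau> \<tau>'
    using eval_deterministic[OF that] bij_str_code by (meson bij_is_inj injD)
  have M: "M \<sigma> = Some \<tau> \<longleftrightarrow> ?R \<sigma> \<tau>" for \<sigma> \<tau>
    unfolding M_def using someI[of "?R \<sigma>"] uniq by auto
  have "prefix_free_machine M"
    unfolding prefix_free_machine_def partial_recursive_def prefix_free_def
  proof (intro conjI ballI notI)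
    show "\<exists>p. oracle_free p \<and> (\<forall>\<sigma> \<tau>. M \<sigma> = Some \<tau> \<longleftrightarrow>
        eval (\<lambda>_. 0) p [str_code \<sigma>] (str_code \<tau>))"
      using M p by blast
    fix \<sigma> \<tau> assume "\<sigma> \<in> dom M" "\<tau> \<in> dom M" "strict_prefix \<sigma> \<tau>"
    then show False using M pf by (auto simp: strict_prefix_def prefix_def)
  qed
  with U M that show thesis by (metis universal_machine_def)
qed

text \<open>\<open>K\<close> takes a \<open>LEAST\<close>, which is meaningful only if every string
  has a description. Simulating the machine that sends 1^k 0 to the string with code k provides one:
  its domain is prefix-free and \<open>str_code\<close> is onto.\<close>

lemma universal_machine_surj:
  assumes "universal_machine U"
  shows "\<exists>\<pi>. U \<pi> = Some \<tau>"
proof -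
  \<comment> \<open>The code of 1^k 0. The program \<open>p\<close> searches for k with c k = n,
    testing equality by the sum of both truncated differences.\<close>
  define c where "c k = 3 * 2 ^ k - (2::nat)" for k
  define P where "P = Comp Pred_prog [Comp Pred_prog
    [Comp Mult_prog [Const_prog 3, Comp Pow2_prog [Proj 0]]]]"
  define p where "p = Mu (Comp Add_prog [Comp Sub_prog [P, Proj 1], Comp Sub_prog [Proj 1, P]])"
  have c: "str_code (replicate k True @ [False]) = c k" for k
  proof (induction k)
    case (Suc k)
    have "(2::nat) ^ k \<ge> 1" by simp
    then have "Suc (Suc (2 * (3 * 2 ^ k - 2))) = 6 * 2 ^ k - (2::nat)" by linarith
    with Suc show ?case by (simp add: c_def)
  qed (simp add: c_def)
  have c_inj: "j = k" if "c j = c k" for j k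
  proof -
    have "(2::nat) ^ j \<ge> 1" "(2::nat) ^ k \<ge> 1" by simp_all
    with that have "(2::nat) ^ j = 2 ^ k" unfolding c_def by linarith
    then show ?thesis by simp
  qed
  have p: "eval g p [n] k \<longleftrightarrow> n = c k" for g n k
  proof -
    have P: "eval g P (m # xs) y \<longleftrightarrow> y = c m" for m xs y
      unfolding P_def c_def by auto
    have neq: "(\<exists>y. Suc y = x - z + (z - x)) \<longleftrightarrow> x \<noteq> z" for x z :: nat
      by presburger
    have "eval g p [n] k \<longleftrightarrow> c k = n \<and> (\<forall>m<k. n \<noteq> c m)"
      unfolding p_def by (auto simp: eval_Mu_iff P neq)
    then show ?thesis using c_inj by blast
  qed
  have P: "eval g p [str_code \<sigma>] k \<longleftrightarrow> \<sigma> = replicate k True @ [False]" for g \<sigma> k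
    unfolding p c[symmetric] using bij_str_code by (metis bij_is_inj injD)
  have rep: "\<xi> = []" if "(replicate k True @ [False]) @ \<xi> = replicate l True @ [False]" for k l \<xi>
    using that
  proof (induction k arbitrary: l)
    case 0
    then show ?case by (cases l) auto
  next
    case (Suc k)
    then show ?case by (cases l) auto
  qed
  have "oracle_free p" by (simp add: p_def P_def)
  then obtain \<rho> where "\<And>\<sigma> \<tau>. U (\<rho> @ \<sigma>) = Some \<tau> \<longleftrightarrow> eval (\<lambda>_. 0) p [str_code \<sigma>] (str_code \<tau>)"
    using prog_machine[OF assms, of p] rep unfolding P by metis
  then show ?thesis using P by blast
qed

lemma K_witness:
  assumes "universal_machine U"
  obtains \<pi> where "U \<pi> = Some \<tau>" "length \<pi> = K U \<tau>"
proof -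
  have "\<exists>n. \<exists>\<pi>. length \<pi> = n \<and> U \<pi> = Some \<tau>"
    using universal_machine_surj[OF assms] by blast
  from LeastI_ex[OF this] that show thesis unfolding K_def by blast
qed

lemma K_le: "U \<pi> = Some \<tau> \<Longrightarrow> K U \<tau> \<le> length \<pi>"
  unfolding K_def by (blast intro: Least_le)

section \<open>Sampling a string along an arithmetic progression\<close>

text \<open>Working on the code \<open>z\<close> makes this arithmetic: letter i is digit i of
  \<open>Suc z\<close>. Positions past the end read the leading 1 or zeros, which keeps it
  total.\<close>

definition sample :: "nat \<Rightarrow> nat \<Rightarrow> nat \<Rightarrow> nat \<Rightarrow> bool list" where
  "sample t u r z = map (\<lambda>j. odd (Suc z div 2 ^ (r + j * 2 ^ u))) [0..<2 ^ t]"

text \<open>The hypothesis puts the last position r + (2^t - 1) 2^u below the length; 2^u stands on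
  the right to avoid a harmful truncated difference.\<close>

lemma sample_str_code:
  assumes "r + 2 ^ (t + u) \<le> length \<tau> + 2 ^ u - 1"
  shows "sample t u r (str_code \<tau>) = map (\<lambda>j. \<tau> ! (r + j * 2 ^ u)) [0..<2 ^ t]"
proof -
  have "r + j * 2 ^ u < length \<tau>" if "j < 2 ^ t" for j
  proof -
    have "Suc j * 2 ^ u \<le> 2 ^ t * 2 ^ u" using that by (intro mult_right_mono) auto
    then have "j * 2 ^ u + 2 ^ u \<le> 2 ^ (t + u)" by (simp add: power_add)
    moreover have "(2::nat) ^ u \<ge> 1" by simp
    ultimately show ?thesis using assms by linarith
  qed
  then show ?thesis by (simp add: sample_def str_code_nth)
qed

definition Bits_prog :: prog where
  "Bits_prog = PrimRec Zero (Comp Add_prog [Proj 1, Comp Mult_prog [Comp Pow2_prog [Proj 0],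
     Comp Parity_prog [Comp Shift_prog
       [Comp Add_prog [Proj 3, Comp Mult_prog [Proj 0, Comp Pow2_prog [Proj 2]]],
        Comp Succ [Proj 4]]]]])"

text \<open>The first summand is the leading 1 at place 2^t, less one to return from the successor
  to the code.\<close>

definition Sample_prog :: prog where
  "Sample_prog = Comp Add_prog [Comp Pred_prog [Comp Pow2_prog [Comp Pow2_prog [Proj 0]]],
     Comp Bits_prog [Comp Pow2_prog [Proj 0], Proj 1, Proj 2, Proj 3]]"

lemma eval_Sample [simp]:
  "eval g Sample_prog [t, u, r, z] y \<longleftrightarrow> y = str_code (sample t u r z)"
proof -
  let ?b = "\<lambda>j. Suc z div 2 ^ (r + j * 2 ^ u)"
  have B: "eval g Bits_prog [n, u, r, z] y \<longleftrightarrow> y = (\<Sum>j<n. 2 ^ j * (?b j mod 2))" for n y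
    unfolding Bits_prog_def by (rule eval_PrimRec_total) auto
  have S: "Suc (str_code (map (\<lambda>j. odd (?b j)) [0..<n])) = 2 ^ n + (\<Sum>j<n. 2 ^ j * (?b j mod 2))" for n
  proof (induction n)
    case (Suc n)
    then show ?case by (cases "odd (?b n)") (simp_all add: str_code_append mod_2_eq_odd)
  qed simp
  have "str_code (sample t u r z) = 2 ^ 2 ^ t - 1 + (\<Sum>j<2 ^ t. 2 ^ j * (?b j mod 2))"
    using S[of "2 ^ t"] unfolding sample_def by simp
  then show ?thesis unfolding Sample_prog_def by (simp add: B)
qed

lemma oracle_free_Sample [simp]: "oracle_free Sample_prog"
  by (simp add: Sample_prog_def Bits_prog_def)

section \<open>Self-delimiting unary numbers and the decoding machine\<close>

definition leading_ones :: "bool list \<Rightarrow> nat \<Rightarrow> bool" where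
  "leading_ones \<sigma> t \<longleftrightarrow> t < length \<sigma> \<and> \<not> \<sigma> ! t \<and> (\<forall>m<t. \<sigma> ! m)"

text \<open>A code is odd exactly when the string starts with False, and the empty rest has the even
  code 0. So a search that runs past the end never halts, on which prefix-freeness of the decoder
  relies.\<close>

definition Ones_prog :: prog where
  "Ones_prog = Mu (Comp Sub_prog [Comp Parity_prog [Drop_prog], Comp Succ [Zero]])"

lemma eval_Ones [simp]: "eval g Ones_prog [str_code \<sigma>] t \<longleftrightarrow> leading_ones \<sigma> t"
proof -
  have d: "even (str_code (drop m \<sigma>)) \<longleftrightarrow> m < length \<sigma> \<longrightarrow> \<sigma> ! m" for m
    using odd_str_code_iff[of "drop m \<sigma>"]
    by (cases "m < length \<sigma>") (auto simp: Cons_nth_drop_Suc[symmetric])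
  have "eval g Ones_prog [str_code \<sigma>] t \<longleftrightarrow>
      odd (str_code (drop t \<sigma>)) \<and> (\<forall>m<t. even (str_code (drop m \<sigma>)))"
    unfolding Ones_prog_def
    by (auto simp: eval_Mu_iff str_code_drop mod_2_eq_odd split: if_splits)
  then show ?thesis unfolding d leading_ones_def by (metis less_trans)
qed

lemma leading_ones_append: "leading_ones \<sigma> t \<Longrightarrow> leading_ones (\<sigma> @ \<xi>) t"
  by (auto simp: leading_ones_def nth_append)

lemma leading_ones_unique: "leading_ones \<sigma> s \<Longrightarrow> leading_ones \<sigma> t \<Longrightarrow> s = t"
  by (metis leading_ones_def nat_neq_iff)

lemma leading_ones_replicate: "leading_ones (replicate t True @ False # \<rho>) t"
  by (auto simp: leading_ones_def nth_append)

text \<open>The machine decodes \<open>1\<^sup>t 0 1\<^sup>u 0 b 1\<^sup>v 0 \<pi>\<close> with \<open>|b| = t + u\<close>, where the bits of \<open>b\<close> give the offset.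
  The block \<open>1\<^sup>v 0\<close> carries no information; it forces \<open>b\<close> to have full length.\<close>

definition "Decode_prog4 p = Comp Sample_prog [Proj 0, Proj 1, Proj 2,
  Comp p [Comp Drop_prog [Comp Succ [Comp Ones_prog [Proj 3]], Proj 3]]]"
definition "Decode_prog3 p = Comp (Decode_prog4 p) [Proj 0, Proj 1,
  Comp Mod2_prog [Comp Add_prog [Proj 0, Proj 1], Comp Succ [Proj 2]],
  Comp Drop_prog [Comp Add_prog [Proj 0, Proj 1], Proj 2]]"
definition "Decode_prog2 p = Comp (Decode_prog3 p) [Proj 0, Proj 1,
  Comp Drop_prog [Comp Succ [Proj 1], Proj 2]]"
definition "Decode_prog1 p = Comp (Decode_prog2 p) [Proj 0, Comp Ones_prog [Proj 1], Proj 1]"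
definition "Decode_prog0 p = Comp (Decode_prog1 p) [Proj 0,
  Comp Drop_prog [Comp Succ [Proj 0], Proj 1]]"
definition "Decode_prog p = Comp (Decode_prog0 p) [Ones_prog, Proj 0]"

lemma oracle_free_Decode: "oracle_free p \<Longrightarrow> oracle_free (Decode_prog p)"
  by (simp add: Decode_prog_def Decode_prog0_def Decode_prog1_def Decode_prog2_def
      Decode_prog3_def Decode_prog4_def Ones_prog_def)

lemma eval_Drop_str_code: "eval g Drop_prog [k, str_code \<sigma>] y \<longleftrightarrow> y = str_code (drop k \<sigma>)"
  by (simp add: str_code_drop)

lemma eval_Decode:
  "eval g (Decode_prog p) [str_code \<sigma>] y \<longleftrightarrow>
    (\<exists>t. leading_ones \<sigma> t \<and> (\<exists>u. leading_ones (drop (Suc t) \<sigma>) u \<and>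
      (let \<rho> = drop (Suc u) (drop (Suc t) \<sigma>); \<rho>' = drop (t + u) \<rho> in
        \<exists>v. leading_ones \<rho>' v \<and> (\<exists>z. eval g p [str_code (drop (Suc v) \<rho>')] z \<and>
          y = str_code (sample t u (Suc (str_code \<rho>) mod 2 ^ (t + u)) z)))))"
proof -
  note [simp] = eval_Drop_str_code
  note [simp del] = eval_Drop drop_drop drop_Suc_Cons
  have 4: "eval g (Decode_prog4 p) [t, u, r, str_code \<rho>] y \<longleftrightarrow>
      (\<exists>v. leading_ones \<rho> v \<and> (\<exists>z. eval g p [str_code (drop (Suc v) \<rho>)] z \<and>
        y = str_code (sample t u r z)))" for t u r \<rho>
    unfolding Decode_prog4_def by auto
  have 3: "eval g (Decode_prog3 p) [t, u, str_code \<rho>] y \<longleftrightarrow>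
      eval g (Decode_prog4 p) [t, u, Suc (str_code \<rho>) mod 2 ^ (t + u), str_code (drop (t + u) \<rho>)] y"
    for t u \<rho>
    unfolding Decode_prog3_def by simp
  have 2: "eval g (Decode_prog2 p) [t, u, str_code \<rho>] y \<longleftrightarrow>
      eval g (Decode_prog3 p) [t, u, str_code (drop (Suc u) \<rho>)] y" for t u \<rho>
    unfolding Decode_prog2_def by simp
  have 1: "eval g (Decode_prog1 p) [t, str_code \<rho>] y \<longleftrightarrow>
      (\<exists>u. leading_ones \<rho> u \<and> eval g (Decode_prog2 p) [t, u, str_code \<rho>] y)" for t \<rho>
    unfolding Decode_prog1_def by simp
  have 0: "eval g (Decode_prog0 p) [t, str_code \<sigma>] y \<longleftrightarrow>
      eval g (Decode_prog1 p) [t, str_code (drop (Suc t) \<sigma>)] y" for t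
    unfolding Decode_prog0_def by simp
  have "eval g (Decode_prog p) [str_code \<sigma>] y \<longleftrightarrow>
      (\<exists>t. leading_ones \<sigma> t \<and> eval g (Decode_prog0 p) [t, str_code \<sigma>] y)"
    unfolding Decode_prog_def by simp
  then show ?thesis unfolding 0 1 2 3 4 Let_def .
qed

text \<open>Prepending 1^t 0 1^u 0 b 0 to a shortest description of \<tau>, with b spelling the
  offset, costs 2 (t + u) + 3 letters; simulating the decoder adds a prefix of constant
  length.\<close>

lemma K_sample:
  assumes U: "universal_machine U"
  obtains d where "\<And>t u r \<tau>. r < 2 ^ (t + u) \<Longrightarrow>
    K U (sample t u r (str_code \<tau>)) \<le> K U \<tau> + 2 * (t + u) + d"
proof -
  obtain p where p: "oracle_free p"
    and Up: "\<And>\<sigma> \<tau>. U \<sigma> = Some \<tau> \<longleftrightarrow> eval (\<lambda>_. 0) p [str_code \<sigma>] (str_code \<tau>)"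
    using U unfolding universal_machine_def prefix_free_machine_def partial_recursive_def by blast
  have dom: "\<exists>\<tau>. U \<sigma> = Some \<tau>" if "eval (\<lambda>_. 0) p [str_code \<sigma>] z" for \<sigma> z
    using that Up bij_str_code by (metis bij_pointE)
  have pf: "\<xi> = []" if "U \<sigma> = Some \<tau>" "U (\<sigma> @ \<xi>) = Some \<tau>'" for \<sigma> \<xi> \<tau> \<tau>'
    using that U unfolding universal_machine_def prefix_free_machine_def prefix_free_def
    by (metis append_self_conv domI prefixI strict_prefixI)
  \<comment> \<open>Extending an accepted input leaves the parsed t, u, b, v unchanged, so
    \<open>U\<close> halts on a string and on its extension by \<xi>; its domain is
    prefix-free.\<close>
  have "\<xi> = []" if y: "eval (\<lambda>_. 0) (Decode_prog p) [str_code \<sigma>] y"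
    and z: "eval (\<lambda>_. 0) (Decode_prog p) [str_code (\<sigma> @ \<xi>)] z" for \<sigma> \<xi> y z
  proof -
    have split: "drop (Suc k) (\<rho> @ \<xi>) = drop (Suc k) \<rho> @ \<xi>" "k = l"
      if "leading_ones \<rho> k" "leading_ones (\<rho> @ \<xi>) l" for \<rho> k l
      using that leading_ones_unique[OF leading_ones_append[OF that(1)] that(2)]
      by (auto simp: leading_ones_def)
    from y obtain t u v z1 where 1: "leading_ones \<sigma> t" "leading_ones (drop (Suc t) \<sigma>) u"
      "leading_ones (drop (t + u) (drop (Suc u) (drop (Suc t) \<sigma>))) v"
      "eval (\<lambda>_. 0) p [str_code (drop (Suc v) (drop (t + u) (drop (Suc u) (drop (Suc t) \<sigma>))))] z1"
      unfolding eval_Decode Let_def by blast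
    from z obtain t' u' v' z2 where 2: "leading_ones (\<sigma> @ \<xi>) t'"
      "leading_ones (drop (Suc t') (\<sigma> @ \<xi>)) u'"
      "leading_ones (drop (t' + u') (drop (Suc u') (drop (Suc t') (\<sigma> @ \<xi>)))) v'"
      "eval (\<lambda>_. 0) p [str_code (drop (Suc v') (drop (t' + u') (drop (Suc u') (drop (Suc t') (\<sigma> @ \<xi>)))))] z2"
      unfolding eval_Decode Let_def by blast
    note t = split[OF 1(1) 2(1)]
    note 3 = 2(2-4)[folded t(2), unfolded t(1)]
    note u = split[OF 1(2) 3(1)]
    note 4 = 3(2,3)[folded u(2), unfolded u(1)]
    let ?\<rho> = "drop (Suc u) (drop (Suc t) \<sigma>)"
    \<comment> \<open>An input ending inside b would leave nothing from which to parse 1^v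
      0.\<close>
    have "t + u \<le> length ?\<rho>"
      using 1(3) unfolding leading_ones_def by (metis drop_all linear list.size(3) not_less_zero)
    then have b: "drop (t + u) (?\<rho> @ \<xi>) = drop (t + u) ?\<rho> @ \<xi>" by simp
    note 5 = 4[unfolded b]
    note v = split[OF 1(3) 5(1)]
    note 6 = 5(2)[folded v(2), unfolded v(1)]
    show ?thesis using dom[OF 1(4)] dom[OF 6] pf by blast
  qed
  note pf' = this
  obtain \<rho> where
    \<rho>: "\<And>\<sigma> \<tau>. U (\<rho> @ \<sigma>) = Some \<tau> \<longleftrightarrow>
      eval (\<lambda>_. 0) (Decode_prog p) [str_code \<sigma>] (str_code \<tau>)"
    by (rule prog_machine[OF U oracle_free_Decode[OF p]]) (erule (1) pf', blast)
  have "K U (sample t u r (str_code \<tau>)) \<le> K U \<tau> + 2 * (t + u) + (length \<rho> + 3)"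
    if r: "r < 2 ^ (t + u)" for t u r \<tau>
  proof -
    obtain \<pi> where \<pi>: "U \<pi> = Some \<tau>" "length \<pi> = K U \<tau>" by (rule K_witness[OF U])
    obtain b where b: "length b = t + u" "\<And>\<rho>. Suc (str_code (b @ \<rho>)) mod 2 ^ (t + u) = r"
      by (rule ex_str_code_mod[OF r]) blast
    let ?\<sigma>3 = "replicate 0 True @ False # \<pi>"
    let ?\<sigma>1 = "replicate u True @ False # b @ ?\<sigma>3"
    let ?\<sigma> = "replicate t True @ False # ?\<sigma>1"
    have d: "drop (Suc k) (replicate k True @ False # \<xi>) = \<xi>" for k \<xi> by simp
    have db: "drop (t + u) (b @ \<xi>) = \<xi>" for \<xi> using b(1) by simp
    have "eval (\<lambda>_. 0) (Decode_prog p) [str_code ?\<sigma>] (str_code (sample t u r (str_code \<tau>)))"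
      unfolding eval_Decode Let_def
    proof (rule exI[of _ t], intro conjI, rule leading_ones_replicate,
        rule exI[of _ u], intro conjI)
      show "leading_ones (drop (Suc t) ?\<sigma>) u"
        unfolding d by (rule leading_ones_replicate)
      show "\<exists>v. leading_ones (drop (t + u) (drop (Suc u) (drop (Suc t) ?\<sigma>))) v \<and>
        (\<exists>z. eval (\<lambda>_. 0) p
          [str_code (drop (Suc v) (drop (t + u) (drop (Suc u) (drop (Suc t) ?\<sigma>))))] z \<and>
        str_code (sample t u r (str_code \<tau>)) = str_code (sample t u
          (Suc (str_code (drop (Suc u) (drop (Suc t) ?\<sigma>))) mod 2 ^ (t + u)) z))"
        unfolding d db b(2)
        using leading_ones_replicate[of 0] \<pi>(1)[unfolded Up] d[of 0] by metis
    qed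
    then have "U (\<rho> @ ?\<sigma>) = Some (sample t u r (str_code \<tau>))" unfolding \<rho> .
    from K_le[of U, OF this] show ?thesis using \<pi>(2) b(1) by simp
  qed
  then show thesis by (rule that)
qed

section \<open>The Toeplitz sequence\<close>

text \<open>A position \<open>i\<close> with \<open>i + 1 = 2\<^sup>a (2 m + 1)\<close> and \<open>m = t + 2\<^bsup>q (a + 1)\<^esup> s\<close>, \<open>t < 2\<^bsup>q (a + 1)\<^esup>\<close>, carries
  bit \<open>s mod 2\<^sup>t\<close> of the given sequence.\<close>

definition toeplitz_index :: "nat \<Rightarrow> nat \<Rightarrow> nat" where
  "toeplitz_index q i = (let a = (LEAST k. odd (Suc i div 2 ^ k)); m = Suc i div 2 ^ Suc a;
     e = q * Suc a in (m div 2 ^ e) mod 2 ^ (m mod 2 ^ e))"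

definition "Val2_prog = Mu (Comp Sub_prog [Comp Parity_prog [Shift_prog], Comp Succ [Zero]])"
definition "Toeplitz_prog1 = Comp Mod2_prog [Comp Mod2_prog [Proj 0, Proj 1], Shift_prog]"
definition "Toeplitz_prog2 q = Comp Toeplitz_prog1
  [Comp Mult_prog [Const_prog q, Comp Succ [Proj 0]], Comp Shift_prog [Comp Succ [Proj 0], Proj 1]]"
definition "Toeplitz_prog q = Comp Oracle
  [Comp (Toeplitz_prog2 q) [Comp Val2_prog [Succ], Succ]]"

text \<open>Repeated halving of a positive number reaches an odd one, so the search halts. At 0 it
  would not; the index program applies it to i + 1.\<close>

lemma eval_Val2:
  assumes "n > 0"
  shows "eval g Val2_prog [n] k \<longleftrightarrow> k = (LEAST k. odd (n div 2 ^ k))"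
proof -
  have "eval g Val2_prog [n] k \<longleftrightarrow> odd (n div 2 ^ k) \<and> (\<forall>m<k. even (n div 2 ^ m))"
    unfolding Val2_prog_def by (auto simp: eval_Mu_iff mod_2_eq_odd split: if_splits)
  also have "\<dots> \<longleftrightarrow> k = (LEAST k. odd (n div 2 ^ k))"
  proof
    assume "odd (n div 2 ^ k) \<and> (\<forall>m<k. even (n div 2 ^ m))"
    then show "k = (LEAST k. odd (n div 2 ^ k))"
      by (intro Least_equality[symmetric]) (auto simp: not_less[symmetric])
  next
    have "\<exists>k. odd (n div 2 ^ k)"
      using assms
    proof (induction n rule: less_induct)
      case (less n)
      show ?case
      proof (cases "even n")
        case True
        with less.prems have "n div 2 < n" "n div 2 > 0" by auto
        from less.IH[OF this] obtain k where "odd (n div 2 div 2 ^ k)" by blast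
        then have "odd (n div 2 ^ Suc k)" by (simp add: div_mult2_eq)
        then show ?thesis by blast
      qed (auto intro: exI[of _ 0])
    qed
    then show "odd (n div 2 ^ k) \<and> (\<forall>m<k. even (n div 2 ^ m))"
      if "k = (LEAST k. odd (n div 2 ^ k))"
      unfolding that using LeastI_ex not_less_Least by metis
  qed
  finally show ?thesis .
qed

text \<open>The index is computed without the oracle, which is then queried once; hence the
  reduction is total for every oracle.\<close>

lemma eval_Toeplitz: "eval g (Toeplitz_prog q) [i] y \<longleftrightarrow> y = g (toeplitz_index q i)"
proof -
  have 1: "eval g Toeplitz_prog1 [e, m] y \<longleftrightarrow> y = (m div 2 ^ e) mod 2 ^ (m mod 2 ^ e)" for e m y
    unfolding Toeplitz_prog1_def by simp
  have 2: "eval g (Toeplitz_prog2 q) [a, x] y \<longleftrightarrow>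
      eval g Toeplitz_prog1 [q * Suc a, x div 2 ^ Suc a] y" for a x y
    unfolding Toeplitz_prog2_def by simp
  show ?thesis
    unfolding Toeplitz_prog_def toeplitz_index_def Let_def by (simp add: eval_Val2 1 2 del: power_Suc)
qed

text \<open>Since (q + 1)(a + 1) = (a + 1) + q (a + 1), the number i + 1 is 2^a (2 m + 1) with m = t
  + 2^(q (a + 1)) s, from which a, t and s are read off.\<close>

lemma toeplitz_index_eq:
  assumes "t < 2 ^ (q * Suc a)"
    and i: "i = 2 ^ a * (2 * t + 1) - 1 + 2 ^ (Suc q * Suc a) * s"
  shows "toeplitz_index q i = s mod 2 ^ t"
proof -
  define m where "m = t + 2 ^ (q * Suc a) * s"
  have "(2::nat) ^ a * (2 * t + 1) > 0" by simp
  then have "Suc i = 2 ^ a * (2 * t + 1) + 2 ^ (Suc q * Suc a) * s" unfolding i by linarith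
  also have "2 ^ (Suc q * Suc a) = (2::nat) ^ Suc a * 2 ^ (q * Suc a)"
    by (simp add: power_add[symmetric] algebra_simps)
  finally have i: "Suc i = 2 ^ a * (2 * m + 1)" by (simp add: m_def algebra_simps)
  have "(LEAST k. odd (Suc i div 2 ^ k)) = a"
  proof (rule Least_equality)
    show "odd (Suc i div 2 ^ a)" unfolding i by (subst nonzero_mult_div_cancel_left) auto
    fix k assume k: "odd (Suc i div 2 ^ k)"
    show "a \<le> k"
    proof (rule ccontr)
      assume "\<not> a \<le> k"
      then have "(2::nat) ^ a = 2 ^ k * (2 * 2 ^ (a - Suc k))"
        by (simp add: power_add[symmetric] power_Suc[symmetric] Suc_diff_Suc del: power_Suc)
      then have "Suc i = 2 ^ k * (2 * (2 ^ (a - Suc k) * (2 * m + 1)))"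
        unfolding i by (simp only: mult.assoc)
      then have "Suc i div 2 ^ k = 2 * (2 ^ (a - Suc k) * (2 * m + 1))" by simp
      with k show False by simp
    qed
  qed
  moreover have "Suc i div 2 ^ Suc a = m"
  proof -
    have "Suc i div 2 ^ a = 2 * m + 1" unfolding i by (subst nonzero_mult_div_cancel_left) auto
    then have "Suc i div 2 ^ a div 2 = m" by simp
    then show ?thesis by (simp only: div_mult2_eq power_Suc2)
  qed
  ultimately show ?thesis
    using assms(1) by (simp add: toeplitz_index_def m_def del: power_Suc mult_Suc_right)
qed

text \<open>The level-\<open>t\<close> positions form a progression of difference \<open>2\<^bsup>toeplitz_exp q t\<^esup>\<close>, about \<open>t\<^bsup>1 + 1/q\<^esup>\<close>.\<close>

definition toeplitz_val :: "nat \<Rightarrow> nat \<Rightarrow> nat" where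
  "toeplitz_val q t = (LEAST a. t < 2 ^ (q * Suc a))"

definition toeplitz_exp :: "nat \<Rightarrow> nat \<Rightarrow> nat" where
  "toeplitz_exp q t = Suc q * Suc (toeplitz_val q t)"

text \<open>Along the level-t progression the bits X 0, ..., X (2^t - 1) recur in order with period
  2^(t + u), u being the exponent. In a window twice as long, such a cycle starts within the first
  half and ends before the window does.\<close>

lemma toeplitz_sample:
  assumes q: "q > 0" and len: "2 ^ Suc (t + toeplitz_exp q t) \<le> length \<tau>"
    and sub: "substring_of \<tau> (\<lambda>i. X (toeplitz_index q i))"
  shows "\<exists>r<2 ^ (t + toeplitz_exp q t). sample t (toeplitz_exp q t) r (str_code \<tau>) = X \<restriction> (2 ^ t)"
proof -
  \<comment> \<open>Level t occurs for every larger a as well; the least admissible one gives the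
    densest progression.\<close>
  define a where "a = toeplitz_val q t"
  define u where "u = toeplitz_exp q t"
  \<comment> \<open>The first position of this progression; it lies below 2^u because t < 2^(q (a +
    1)).\<close>
  define A where "A = 2 ^ a * (2 * t + 1) - (1::nat)"
  have u: "u = Suc q * Suc a" by (simp add: u_def a_def toeplitz_exp_def)
  have "t < 2 ^ t" by (rule less_exp)
  also have "(2::nat) ^ t \<le> 2 ^ (q * Suc t)"
    using q by (intro power_increasing) (cases q, auto)
  finally have ta: "t < 2 ^ (q * Suc a)" unfolding a_def toeplitz_val_def by (rule LeastI)
  have "2 * t + 1 < 2 * 2 ^ (q * Suc a)" using ta by simp
  then have "2 ^ a * (2 * t + 1) < 2 ^ a * (2 * 2 ^ (q * Suc a))"
    by (rule mult_strict_left_mono) simp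
  also have "\<dots> = 2 ^ u" by (simp add: u power_add[symmetric] power_Suc[symmetric] algebra_simps del: power_Suc)
  also have "\<dots> \<le> 2 ^ (t + u)" by simp
  finally have A: "A < 2 ^ (t + u)" unfolding A_def by simp
  obtain x where x: "\<tau> = map (\<lambda>i. X (toeplitz_index q i)) [x..<x + length \<tau>]"
    using sub unfolding substring_of_def by blast
  \<comment> \<open>The distance from x to the first position at or after it that is congruent to A
    modulo 2^(t + u); x (2^(t + u) - 1) serves as -x among the naturals.\<close>
  define r where "r = (A + x * (2 ^ (t + u) - 1)) mod 2 ^ (t + u)"
  have r: "r < 2 ^ (t + u)" by (simp add: r_def)
  have "(x + r) mod 2 ^ (t + u) = (x + (A + x * (2 ^ (t + u) - 1))) mod 2 ^ (t + u)"
    unfolding r_def by (simp add: mod_add_right_eq)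
  also have "x + x * (2 ^ (t + u) - 1) = x * 2 ^ (t + u)"
    by (metis One_nat_def Suc_pred mult_Suc_right zero_less_numeral zero_less_power)
  then have "x + (A + x * (2 ^ (t + u) - 1)) = A + x * 2 ^ (t + u)" by linarith
  finally have "(x + r) mod 2 ^ (t + u) = A" using A by simp
  then obtain s where s: "x + r = A + 2 ^ (t + u) * s"
    by (metis mod_div_mult_eq mult.commute add.commute)
  have bound: "r + 2 ^ (t + u) \<le> length \<tau> + 2 ^ u - 1"
    using len r unfolding u_def[symmetric] by simp
  have "\<tau> ! (r + j * 2 ^ u) = X j" if j: "j < 2 ^ t" for j
  proof -
    have "Suc j * 2 ^ u \<le> 2 ^ t * 2 ^ u" using j by (intro mult_right_mono) auto
    then have "r + j * 2 ^ u < length \<tau>"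
      using r len unfolding u_def[symmetric] by (simp add: power_add)
    then have "\<tau> ! (r + j * 2 ^ u) = X (toeplitz_index q (x + r + j * 2 ^ u))"
      by (subst x) (simp add: add.assoc)
    also have "x + r + j * 2 ^ u = A + 2 ^ u * (2 ^ t * s + j)"
      unfolding s by (simp add: power_add algebra_simps)
    also have "toeplitz_index q \<dots> = (2 ^ t * s + j) mod 2 ^ t"
      by (rule toeplitz_index_eq[OF ta]) (simp only: A_def u)
    finally show ?thesis using j by simp
  qed
  then show ?thesis
    using r sample_str_code[OF bound] unfolding u_def[symmetric] restrict_def
    by (intro exI[of _ r]) (auto cong: map_cong)
qed

section \<open>Size of the differences, and the growth comparison\<close>

lemma toeplitz_val_le:
  assumes "q > 0" "t > 0"
  shows "2 ^ (q * toeplitz_val q t) \<le> t"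
proof (cases "toeplitz_val q t")
  case (Suc a)
  then have "\<not> t < 2 ^ (q * Suc a)" unfolding toeplitz_val_def by (intro not_less_Least) simp
  then show ?thesis using Suc by simp
qed (use assms in simp)

text \<open>A crude linear bound, enough for the O(t) overhead of a description.\<close>

lemma toeplitz_exp_le:
  assumes "q > 0" "t > 0"
  shows "toeplitz_exp q t \<le> Suc q * Suc t"
proof -
  have "toeplitz_val q t < 2 ^ toeplitz_val q t" by (rule less_exp)
  also have "(2::nat) ^ toeplitz_val q t \<le> 2 ^ (q * toeplitz_val q t)"
    using assms by (intro power_increasing) auto
  also have "\<dots> \<le> t" by (rule toeplitz_val_le[OF assms])
  finally show ?thesis unfolding toeplitz_exp_def by (intro mult_le_mono2) simp
qed

text \<open>With v the valuation, 2^((q + 1) v) is the power 1 + 1/q of 2^(q v) <= t; the remaining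
  q + 1 in the exponent gives the constant factor.\<close>

lemma two_power_toeplitz_exp_le:
  assumes "q > 0" "t > 0"
  shows "2 ^ toeplitz_exp q t \<le> 2 ^ Suc q * real t powr (1 + 1 / real q)"
proof -
  let ?v = "toeplitz_val q t"
  have "2 powr real (q * ?v) = real (2 ^ (q * ?v))"
    unfolding of_nat_power of_nat_numeral by (rule powr_realpow) simp
  also have "\<dots> \<le> real t" using toeplitz_val_le[OF assms] by (simp only: of_nat_le_iff)
  finally have "(2 powr real (q * ?v)) powr (1 + 1 / real q) \<le> real t powr (1 + 1 / real q)"
    by (intro powr_mono2) auto
  moreover have "real (q * ?v) * (1 + 1 / real q) = real (Suc q * ?v)"
    using assms by (simp add: field_simps)
  then have "(2 powr real (q * ?v)) powr (1 + 1 / real q) = 2 powr real (Suc q * ?v)"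
    by (simp only: powr_powr)
  moreover have "2 powr real (Suc q * ?v) = 2 ^ (Suc q * ?v)"
    by (rule powr_realpow) simp
  ultimately have "2 ^ (Suc q * ?v) \<le> real t powr (1 + 1 / real q)" by simp
  then have "2 ^ Suc q * 2 ^ (Suc q * ?v) \<le> 2 ^ Suc q * real t powr (1 + 1 / real q)"
    by (intro mult_left_mono) auto
  then show ?thesis by (simp only: toeplitz_exp_def mult_Suc_right power_add)
qed

text \<open>Relative to 2^t / t^\<alpha> the first summand is C (t + 1)^\<delta> t^(\<alpha> -
  \<beta>), which tends to 0, and the second decays exponentially up to powers of t; each is
  eventually at most one half. They stand for the complexity demanded of a substring and for the
  cost of describing the sample.\<close>

lemma growth:
  fixes \<alpha> \<beta> \<delta> C D :: real
  assumes "\<alpha> + \<delta> < \<beta>" "\<delta> > 0"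
  shows "\<forall>\<^sub>F t in sequentially. C * 2 ^ t * real (Suc t) powr \<delta> / real t powr \<beta> + D * real (Suc t)
    \<le> 2 ^ t / real t powr \<alpha>"
proof -
  have "((\<lambda>t. real (Suc t) powr \<delta> * real t powr (\<alpha> - \<beta>)) \<longlongrightarrow> 0) sequentially"
  proof -
    have lim: "((\<lambda>t. (2 * real t) powr \<delta> * real t powr (\<alpha> - \<beta>)) \<longlongrightarrow> 0) sequentially"
    proof -
      have "((\<lambda>t. 2 powr \<delta> * real t powr (\<alpha> + \<delta> - \<beta>)) \<longlongrightarrow> 2 powr \<delta> * 0) sequentially"
        using assms
        by (intro tendsto_mult tendsto_const tendsto_neg_powr filterlim_real_sequentially) auto
      then show ?thesis
        by (simp add: powr_mult powr_add[symmetric] mult.assoc add_diff_eq add.commute)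
    qed
    show ?thesis
    proof (rule tendsto_sandwich[OF _ _ tendsto_const lim])
      show "\<forall>\<^sub>F t in sequentially. real (Suc t) powr \<delta> * real t powr (\<alpha> - \<beta>)
          \<le> (2 * real t) powr \<delta> * real t powr (\<alpha> - \<beta>)"
        using eventually_ge_at_top[of 1]
        by eventually_elim (use assms in \<open>auto intro!: mult_right_mono powr_mono2\<close>)
    qed auto
  qed
  then have "((\<lambda>t. \<bar>C\<bar> * (real (Suc t) powr \<delta> * real t powr (\<alpha> - \<beta>))) \<longlongrightarrow> \<bar>C\<bar> * 0) sequentially"
    by (intro tendsto_mult tendsto_const)
  then have "\<forall>\<^sub>F t in sequentially. \<bar>C\<bar> * (real (Suc t) powr \<delta> * real t powr (\<alpha> - \<beta>)) < 1 / 2"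
    by (rule order_tendstoD) simp
  moreover have "\<forall>\<^sub>F t in sequentially. D * real (Suc t) \<le> 2 ^ t / real t powr \<alpha> / 2"
    by real_asymp
  ultimately show ?thesis
    using eventually_gt_at_top[of 0]
  proof eventually_elim
    case (elim t)
    let ?f = "2 ^ t / real t powr \<alpha>"
    have "C * 2 ^ t * real (Suc t) powr \<delta> / real t powr \<beta> =
        C * (real (Suc t) powr \<delta> * real t powr (\<alpha> - \<beta>)) * ?f"
      using elim(3) by (simp add: powr_diff)
    also have "\<dots> \<le> \<bar>C\<bar> * (real (Suc t) powr \<delta> * real t powr (\<alpha> - \<beta>)) * ?f"
      by (intro mult_right_mono) auto
    also have "\<dots> \<le> 1 / 2 * ?f"
      using elim(1) by (intro mult_right_mono) auto
    finally show ?case using elim(2) by simp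
  qed
qed

section \<open>The reduction\<close>

lemma n_over_log_two_power:
  assumes "(LEAST a. suitable_from \<gamma> a) \<le> 2 ^ t"
  shows "n_over_log \<gamma> (2 ^ t) = 2 ^ t / real t powr \<gamma>"
  using assms by (simp add: n_over_log_def n_over_log_raw_def max_absorb1 log_nat_power)

text \<open>Numerator and denominator are estimated separately: m bounds the length from above, t
  bounds its logarithm from below, and \<gamma> >= 0 makes the power monotone.\<close>

lemma n_over_log_le:
  assumes "(LEAST a. suitable_from \<gamma> a) \<le> n" "\<gamma> \<ge> 0" "0 < t" "2 ^ t \<le> n" "n \<le> m"
  shows "n_over_log \<gamma> n \<le> real m / real t powr \<gamma>"
proof -
  have "real t \<le> log 2 (real n)" using assms(4) by (rule le_log2_of_power)
  then have "real t powr \<gamma> \<le> log 2 (real n) powr \<gamma>"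
    using assms by (intro powr_mono2) auto
  then have "real n / log 2 (real n) powr \<gamma> \<le> real m / real t powr \<gamma>"
    using assms by (intro frac_le) auto
  then show ?thesis using assms by (simp add: n_over_log_def n_over_log_raw_def max_absorb1)
qed

lemma toeplitz_COMPLEX_imp_SC:
  fixes \<alpha> \<beta> :: real
  assumes U: "universal_machine U" and q: "q > 0" and \<beta>: "\<beta> > 0"
    and less: "\<alpha> + (1 + 1 / real q) < \<beta>" and X: "X \<in> COMPLEX U (n_over_log \<alpha>)"
  shows "(\<lambda>i. X (toeplitz_index q i)) \<in> SC U (n_over_log \<beta>)"
proof -
  obtain c :: nat where c: "n_over_log \<alpha> n - real c \<le> real (K U (X \<restriction> n))" for n
    using X unfolding COMPLEX_def by blast
  obtain d where d: "\<And>t u r \<tau>. r < 2 ^ (t + u) \<Longrightarrow>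
      K U (sample t u r (str_code \<tau>)) \<le> K U \<tau> + 2 * (t + u) + d"
    using K_sample[OF U] by blast
  let ?f = "\<lambda>t. 2 ^ t / real t powr \<alpha>"
  \<comment> \<open>The window length that \<open>toeplitz_sample\<close> demands at level
    t.\<close>
  let ?len = "\<lambda>t. 2 ^ Suc (t + toeplitz_exp q t) :: nat"
  define \<delta> where "\<delta> = 1 + 1 / real q"
  define C where "C = (4 * 2 ^ Suc q :: real)"
  define D where "D = (2 * (1 + real (Suc q)) :: real)"
  have "\<forall>\<^sub>F t in sequentially. C * 2 ^ t * real (Suc t) powr \<delta> / real t powr \<beta> + D * real (Suc t) \<le> ?f t"
    using less by (intro growth) (auto simp: \<delta>_def intro: add_pos_nonneg)
  then obtain T where T: "\<And>t. t \<ge> T \<Longrightarrow>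
      C * 2 ^ t * real (Suc t) powr \<delta> / real t powr \<beta> + D * real (Suc t) \<le> ?f t"
    unfolding eventually_sequentially by blast
  \<comment> \<open>From t0 on, the growth estimate holds and 2^t clears both thresholds below which
    \<open>n_over_log\<close> is constant.\<close>
  define t0 where "t0 = Max {T, 1, LEAST a. suitable_from \<alpha> a, LEAST a. suitable_from \<beta> a}"
  have t0: "T \<le> t0" "1 \<le> t0" "(LEAST a. suitable_from \<alpha> a) \<le> t0" "(LEAST a. suitable_from \<beta> a) \<le> t0"
    unfolding t0_def by auto
  have pow: "a \<le> 2 ^ t" if "a \<le> t" for a t :: nat
    using that less_exp[of t] by linarith
  \<comment> \<open>The finitely many smaller lengths are absorbed in the constant.\<close>
  define B where "B = Max ((\<lambda>n. n_over_log \<beta> n) ` {..?len t0})"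
  have "n_over_log \<beta> (length \<tau>) - real (c + d + nat \<lceil>B\<rceil>) \<le> real (K U \<tau>)"
    if sub: "substring_of \<tau> (\<lambda>i. X (toeplitz_index q i))" for \<tau>
  proof (cases "length \<tau> < ?len t0")
    case True
    then have "n_over_log \<beta> (length \<tau>) \<le> B" unfolding B_def by (intro Max_ge) auto
    then show ?thesis by linarith
  next
    case False
    \<comment> \<open>The level used for \<tau>. Leastness, or at t0 the case assumption, gives the
      lower bound \<open>?len t\<close> on the length.\<close>
    define t where "t = (LEAST t. t0 \<le> t \<and> length \<tau> < ?len (Suc t))"
    have "length \<tau> \<le> 2 ^ max t0 (length \<tau>)" by (rule pow) simp
    also have "\<dots> < ?len (Suc (max t0 (length \<tau>)))" by (rule power_strict_increasing) auto
    finally have "length \<tau> < ?len (Suc (max t0 (length \<tau>)))" .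
    from conjI[OF max.cobounded1 this] have "t0 \<le> t \<and> length \<tau> < ?len (Suc t)"
      unfolding t_def by (rule LeastI)
    then have t: "t0 \<le> t" "length \<tau> < ?len (Suc t)" by blast+
    have len: "?len t \<le> length \<tau>"
    proof (cases "t = t0")
      case False
      with t obtain t' where t': "t = Suc t'" "t0 \<le> t'" by (cases t) auto
      then have "t' < t" by simp
      then have "\<not> (t0 \<le> t' \<and> length \<tau> < ?len (Suc t'))"
        unfolding t_def by (rule not_less_Least)
      then show ?thesis using t' by simp
    qed (use False in simp)
    have t1: "t > 0" "T \<le> t" "(LEAST a. suitable_from \<alpha> a) \<le> 2 ^ t"
      using t0 t(1) by (auto intro!: pow)
    have len': "2 ^ t \<le> length \<tau>"
      by (rule order_trans[OF power_increasing len]) auto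
    then have "(LEAST a. suitable_from \<beta> a) \<le> length \<tau>"
      using t0(4) t(1) pow[of "LEAST a. suitable_from \<beta> a" t] by simp
    then have "n_over_log \<beta> (length \<tau>) \<le> real (?len (Suc t)) / real t powr \<beta>"
      using \<beta> t1(1) len' t(2) by (intro n_over_log_le) auto
    also have "\<dots> \<le> C * 2 ^ t * real (Suc t) powr \<delta> / real t powr \<beta>"
    proof (rule divide_right_mono)
      \<comment> \<open>The length is bounded above by level t + 1, whence the argument t + 1 in
        \<open>growth\<close>.\<close>
      have "real (?len (Suc t)) = 4 * 2 ^ t * 2 ^ toeplitz_exp q (Suc t)"
        by (simp add: power_add)
      also have "\<dots> \<le> 4 * 2 ^ t * (2 ^ Suc q * real (Suc t) powr \<delta>)"
        unfolding \<delta>_def using q by (intro mult_left_mono two_power_toeplitz_exp_le) auto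
      finally show "real (?len (Suc t)) \<le> C * 2 ^ t * real (Suc t) powr \<delta>"
        by (simp add: C_def mult_ac)
    qed simp
    also have "\<dots> \<le> ?f t - D * real (Suc t)" using T[OF t1(2)] by simp
    also have "?f t = n_over_log \<alpha> (2 ^ t)" using n_over_log_two_power[OF t1(3)] by simp
    also have "\<dots> \<le> real (K U (X \<restriction> (2 ^ t))) + real c" using c[of "2 ^ t"] by simp
    finally have "n_over_log \<beta> (length \<tau>) + D * real (Suc t)
        \<le> real (K U (X \<restriction> (2 ^ t))) + real c" by simp
    moreover have "K U (X \<restriction> (2 ^ t)) \<le> K U \<tau> + 2 * (t + toeplitz_exp q t) + d"
      using toeplitz_sample[OF q len sub] d by metis
    then have "real (K U (X \<restriction> (2 ^ t))) \<le> real (K U \<tau>) + real (2 * (t + toeplitz_exp q t)) + real d"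
      by linarith
    moreover have "real (2 * (t + toeplitz_exp q t)) \<le> D * real (Suc t)"
    proof -
      have "2 * (t + toeplitz_exp q t) \<le> 2 * (Suc t + Suc q * Suc t)"
        by (rule mult_le_mono2[OF add_mono[OF _ toeplitz_exp_le[OF q t1(1)]]]) simp
      also have "\<dots> = 2 * (1 + Suc q) * Suc t" by (simp add: algebra_simps)
      finally have "real (2 * (t + toeplitz_exp q t)) \<le> real (2 * (1 + Suc q) * Suc t)"
        by (rule of_nat_mono)
      also have "\<dots> = D * real (Suc t)" by (simp add: D_def algebra_simps)
      finally show ?thesis .
    qed
    ultimately show ?thesis by linarith
  qed
  then show ?thesis unfolding SC_def by blast
qed

theorem mainTheorem17:
  fixes \<alpha> \<beta> :: rat and U :: "bool list \<rightharpoonup> bool list"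
  assumes "universal_machine U"
    and "0 < \<alpha> + 1" and "\<alpha> + 1 < \<beta>"
  shows "to_baire ` SC U (n_over_log (of_rat \<beta>)) \<le>\<^sub>s
    to_baire ` COMPLEX U (n_over_log (of_rat \<alpha>))"
proof -
  define a b :: real where "a = of_rat \<alpha>" and "b = of_rat \<beta>"
  have ab: "0 < a + 1" "a + 1 < b"
    using assms(2,3)[folded of_rat_less[where 'a = real]] by (auto simp: a_def b_def of_rat_add)
  \<comment> \<open>The slack b - (a + 1) leaves room for 1/q, the price of summable
    densities.\<close>
  then obtain n where n: "inverse (real (Suc n)) < b - (a + 1)"
    using reals_Archimedean[of "b - (a + 1)"] by auto
  define q where "q = Suc n"
  have q: "q > 0" "a + (1 + 1 / real q) < b" using n by (auto simp: q_def inverse_eq_divide)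
  show ?thesis
    unfolding strongly_reducible_def a_def[symmetric] b_def[symmetric]
  proof (intro exI[of _ "Toeplitz_prog q"] ballI)
    fix g assume "g \<in> to_baire ` COMPLEX U (n_over_log a)"
    then obtain X where X: "X \<in> COMPLEX U (n_over_log a)" and g: "g = to_baire X" by blast
    let ?Y = "\<lambda>i. X (toeplitz_index q i)"
    have "?Y \<in> SC U (n_over_log b)"
      using toeplitz_COMPLEX_imp_SC[OF assms(1) q(1) _ q(2) X] ab by simp
    then show "\<exists>h\<in>to_baire ` SC U (n_over_log b). \<forall>i. eval g (Toeplitz_prog q) [i] (h i)"
      by (intro bexI[of _ "to_baire ?Y"]) (auto simp: eval_Toeplitz g to_baire_def)
  qed
qed

end
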